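(* Let $X$ be a locale and $R$ a localic relation on $X$ with open cones. Then $R\subseteq R_{\Uparrow_R,\Downarrow_R}$ as sublocales of $X\times X$.
   Context: Frames and locales. A frame is a complete lattice (order $\sqsubseteq$) in which $x\wedge\bigvee y_i=\bigvee (x\wedge y_i)$; frame maps preserve finite meets and all joins. The category of locales is the opposite of the category of frames: a locale $X$ has a frame of opens $\mathcal{O}X$, and a map $f\colon X\to Y$ is a frame map $f^{-1}\colon\mathcal{O}Y\to\mathcal{O}X$. $L\otimes M$ is the coproduct of frames, generated under joins by the rectangles $x\otimes y=\iota_1(x)\wedge\iota_2(y)$ ($\iota_1,\iota_2$ the coproduct injections); $\mathcal{O}(X\times Y)=\mathcal{O}X\otimes\mathcal{O}Y$. A sublocale of $X$ is (an isomorphism class of) an extremal monomorphism $A\rightarrowtail X$, equivalently a map whose frame map is surjective; $A\subseteq B$ means the inclusion of $A$ factors through that of $B$. Open cone relations. A localic relation on $X$ is a sublocale $r\colon R\rightarrowtail X\times X$; its source and target maps are $s=\mathrm{pr}_1\circ r$, $t=\mathrm{pr}_2\circ r\colon R\to X$. A locale map $f\colon X\to Y$ is open if $f^{-1}$ has a left adjoint $f_!$ with $f_!(U\wedge f^{-1}(V))=f_!(U)\wedge V$. $R$ has open cones if $s,t$ are open; then its induced cones are $\Uparrow_R:=t_!s^{-1}$ and $\Downarrow_R:=s_!t^{-1}\colon\mathcal{O}X\to\mathcal{O}X$. These preserve all joins and are parallel in the sense below. Parallel pairs and induced relation. Functions $\mathsf{u},\mathsf{d}\colon L\to L$ on a frame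 are parallel if $\mathsf{u}(x)\wedge y\sqsubseteq\mathsf{u}(x\wedge\mathsf{d}(y))$ and $x\wedge\mathsf{d}(y)\sqsubseteq\mathsf{d}(\mathsf{u}(x)\wedge y)$ for all $x,y\in L$. Given such a join-preserving pair on $\mathcal{O}X$, let $\sim$ be the binary relation on rectangles of $\mathcal{O}X\otimes\mathcal{O}X$ with $a\otimes b\sim c\otimes d$ iff $\mathsf{u}(a)\wedge b=\mathsf{u}(c)\wedge d$ and $a\wedge\mathsf{d}(b)=c\wedge\mathsf{d}(d)$. An element $o\in\mathcal{O}X\otimes\mathcal{O}X$ is $\sim$-saturated if for all $p\sim q$ and all $w$: $p\wedge w\sqsubseteq o$ iff $q\wedge w\sqsubseteq o$. $R_{\mathsf{u},\mathsf{d}}\rightarrowtail X\times X$ is the sublocale whose frame is the set of $\sim$-saturated elements, with frame map $\mu_\sim(o)=$ the least $\sim$-saturated element above $o$; equivalently, the quotient of $\mathcal{O}X\otimes\mathcal{O}X$ by the frame congruence generated by $\sim$. *)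

theory Defs
  imports "HOL-Library.Lub_Glb"
begin

section \<open>Frames and frame maps\<close>

text \<open>
  The class \<open>complete_distrib_lattice\<close> of the library is completely distributive; a frame only
  has finite meets distributing over arbitrary joins.
  A locale \<open>X\<close> is given by its frame of opens, and a map of locales \<open>X \<rightarrow> Y\<close> by its
  inverse image, a frame map from the opens of \<open>Y\<close> to those of \<open>X\<close>.
\<close>

class frame = complete_lattice +
  assumes inf_Sup_frame: "inf x (Sup A) = Sup (inf x ` A)"

text \<open>
  The frame of a sublocale may be a subset of another lattice, with the induced order, that
  depends on term parameters (see \<open>induced_opens\<close> below). Frames and frame maps are
  therefore also needed on carrier sets; joins and meets are those computed inside the carrier. The
  top and bottom elements are the meet and the join of the empty set.
\<close>

definition frame_on :: "'p::order set \<Rightarrow> bool" where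
  "frame_on S \<longleftrightarrow>
    (\<forall>A\<subseteq>S. \<exists>x. isLub S A x) \<and>
    (\<forall>x\<in>S. \<forall>A\<subseteq>S. \<forall>y m. isLub S A y \<longrightarrow> isGlb S {x, y} m \<longrightarrow>
        isLub S {z. \<exists>a\<in>A. isGlb S {x, a} z} m)"

definition frame_map_on :: "'p::order set \<Rightarrow> 'q::order set \<Rightarrow> ('p \<Rightarrow> 'q) \<Rightarrow> bool" where
  "frame_map_on S T h \<longleftrightarrow>
    h ` S \<subseteq> T \<and>
    (\<forall>A x. A \<subseteq> S \<longrightarrow> isLub S A x \<longrightarrow> isLub T (h ` A) (h x)) \<and>
    (\<forall>A x. A \<subseteq> S \<longrightarrow> finite A \<longrightarrow> isGlb S A x \<longrightarrow> isGlb T (h ` A) (h x))"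

abbreviation frame_map :: "('p::frame \<Rightarrow> 'q::frame) \<Rightarrow> bool" where
  "frame_map \<equiv> frame_map_on UNIV UNIV"

lemma isLub_iff:
  "isLub S A x \<longleftrightarrow> x \<in> S \<and> (\<forall>a\<in>A. a \<le> x) \<and> (\<forall>y\<in>S. (\<forall>a\<in>A. a \<le> y) \<longrightarrow> x \<le> y)"
  by (auto simp: isLub_def leastP_def isUb_def setle_def setge_def)

lemma isGlb_iff:
  "isGlb S A x \<longleftrightarrow> x \<in> S \<and> (\<forall>a\<in>A. x \<le> a) \<and> (\<forall>y\<in>S. (\<forall>a\<in>A. y \<le> a) \<longrightarrow> y \<le> x)"
  by (auto simp: isGlb_def greatestP_def isLb_def setle_def setge_def)

lemma isLub_UNIV_iff: "isLub UNIV A x \<longleftrightarrow> x = Sup (A :: 'a::complete_lattice set)"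
  by (auto simp: isLub_iff Sup_upper Sup_least intro: order.antisym)

lemma isGlb_UNIV_iff: "isGlb UNIV A x \<longleftrightarrow> x = Inf (A :: 'a::complete_lattice set)"
  by (auto simp: isGlb_iff Inf_lower Inf_greatest intro: order.antisym)

lemma frame_on_UNIV: "frame_on (UNIV :: 'a::frame set)"
proof -
  have "{z. \<exists>a\<in>A. z = inf x a} = inf x ` A" for x :: 'a and A
    by auto
  then show ?thesis
    by (simp add: frame_on_def isLub_UNIV_iff isGlb_UNIV_iff inf_Sup_frame)
qed

lemma frame_map_iff:
  "frame_map h \<longleftrightarrow> (\<forall>A. h (Sup A) = Sup (h ` A)) \<and> h top = top \<and> (\<forall>x y. h (inf x y) = inf (h x) (h y))"
  (is "_ \<longleftrightarrow> ?R")
proof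
  assume h: "frame_map h"
  then have fin: "h (Inf A) = Inf (h ` A)" if "finite A" for A
    using that by (simp add: frame_map_on_def isGlb_UNIV_iff)
  have "h (inf x y) = inf (h x) (h y)" for x y
    using fin[of "{x, y}"] by simp
  moreover have "h top = top"
    using fin[of "{}"] by simp
  ultimately show ?R
    using h by (simp add: frame_map_on_def isLub_UNIV_iff)
next
  assume R: ?R
  have "h (Inf A) = Inf (h ` A)" if "finite A" for A
    using that by induction (use R in auto)
  then show "frame_map h"
    using R by (simp add: frame_map_on_def isLub_UNIV_iff isGlb_UNIV_iff)
qed


section \<open>The coproduct of two frames\<close>

text \<open>
  \<open>L \<otimes> M\<close> is constructed as the frame of those down-sets of \<open>L \<times> M\<close> that are closed under
  joins in each coordinate separately, ordered by inclusion. The case \<open>A = {}\<close> makes every pair with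
  a bottom component a member. The universal property is \<open>tensor_universal\<close>.
\<close>

definition coproduct_ideal :: "('a::frame \<times> 'b::frame) set \<Rightarrow> bool" where
  "coproduct_ideal D \<longleftrightarrow>
    (\<forall>a b c d. (a, b) \<in> D \<longrightarrow> c \<le> a \<longrightarrow> d \<le> b \<longrightarrow> (c, d) \<in> D) \<and>
    (\<forall>A b. (\<forall>a\<in>A. (a, b) \<in> D) \<longrightarrow> (Sup A, b) \<in> D) \<and>
    (\<forall>a B. (\<forall>b\<in>B. (a, b) \<in> D) \<longrightarrow> (a, Sup B) \<in> D)"

typedef (overloaded) ('a::frame, 'b::frame) tensor = "{D :: ('a \<times> 'b) set. coproduct_ideal D}"
  by (rule exI[of _ UNIV]) (simp add: coproduct_ideal_def)

definition ideal_hull :: "('a::frame \<times> 'b::frame) set \<Rightarrow> ('a, 'b) tensor" where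
  "ideal_hull S = Abs_tensor (\<Inter>{D. coproduct_ideal D \<and> S \<subseteq> D})"

instantiation tensor :: (frame, frame) complete_lattice
begin

definition "x \<le> y \<longleftrightarrow> Rep_tensor x \<subseteq> Rep_tensor y"
definition "x < y \<longleftrightarrow> Rep_tensor x \<subset> Rep_tensor y"
definition "inf x y = Abs_tensor (Rep_tensor x \<inter> Rep_tensor y)"
definition "sup x y = ideal_hull (Rep_tensor x \<union> Rep_tensor y)"
definition "Inf A = Abs_tensor (\<Inter>(Rep_tensor ` A))"
definition "Sup A = ideal_hull (\<Union>(Rep_tensor ` A))"
definition "top = Abs_tensor UNIV"
definition "bot = ideal_hull {}"

lemma coproduct_ideal_Inter: "(\<And>D. D \<in> \<D> \<Longrightarrow> coproduct_ideal D) \<Longrightarrow> coproduct_ideal (\<Inter>\<D>)"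
  unfolding coproduct_ideal_def[of "\<Inter>\<D>"]
proof (intro conjI allI impI InterI)
  fix D assume D: "\<And>D. D \<in> \<D> \<Longrightarrow> coproduct_ideal D" "D \<in> \<D>"
  note I = D(1)[OF D(2), unfolded coproduct_ideal_def]
  show "(c, d) \<in> D" if "(a, b) \<in> \<Inter>\<D>" "c \<le> a" "d \<le> b" for a b c d
    using I[THEN conjunct1] D(2) that by blast
  show "(Sup A, b) \<in> D" if "\<forall>a\<in>A. (a, b) \<in> \<Inter>\<D>" for A b
    by (rule I[THEN conjunct2, THEN conjunct1, rule_format]) (use D(2) that in blast)
  show "(a, Sup B) \<in> D" if "\<forall>b\<in>B. (a, b) \<in> \<Inter>\<D>" for a B
    by (rule I[THEN conjunct2, THEN conjunct2, rule_format]) (use D(2) that in blast)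
qed

lemma coproduct_ideal_Rep: "coproduct_ideal (Rep_tensor x)"
  using Rep_tensor by auto

lemma Rep_Inf_tensor: "Rep_tensor (Inf A) = \<Inter>(Rep_tensor ` A)"
  unfolding Inf_tensor_def
  by (rule Abs_tensor_inverse) (auto intro!: coproduct_ideal_Inter coproduct_ideal_Rep)

lemma Rep_inf_tensor: "Rep_tensor (inf x y) = Rep_tensor x \<inter> Rep_tensor y"
proof -
  have "coproduct_ideal (\<Inter>{Rep_tensor x, Rep_tensor y})"
    by (rule coproduct_ideal_Inter) (auto intro: coproduct_ideal_Rep)
  then show ?thesis
    by (simp add: inf_tensor_def Abs_tensor_inverse)
qed

lemma Rep_top_tensor: "Rep_tensor top = UNIV"
  by (simp add: top_tensor_def Abs_tensor_inverse coproduct_ideal_def)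

lemma Rep_ideal_hull: "Rep_tensor (ideal_hull S) = \<Inter>{D. coproduct_ideal D \<and> S \<subseteq> D}"
  unfolding ideal_hull_def
  by (rule Abs_tensor_inverse) (auto intro!: coproduct_ideal_Inter)

lemma ideal_hull_le_iff: "ideal_hull S \<le> x \<longleftrightarrow> S \<subseteq> Rep_tensor x"
  unfolding less_eq_tensor_def Rep_ideal_hull using coproduct_ideal_Rep[of x] by blast

instance
proof
  fix x y z :: "('a, 'b) tensor" and A
  show "x < y \<longleftrightarrow> x \<le> y \<and> \<not> y \<le> x"
    by (auto simp: less_tensor_def less_eq_tensor_def)
  show "x \<le> x"
    by (simp add: less_eq_tensor_def)
  show "x \<le> z" if "x \<le> y" "y \<le> z"
    using that by (auto simp: less_eq_tensor_def)
  show "x = y" if "x \<le> y" "y \<le> x"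
    using that by (auto simp: less_eq_tensor_def Rep_tensor_inject[symmetric])
  show "inf x y \<le> x" "inf x y \<le> y"
    by (auto simp: less_eq_tensor_def Rep_inf_tensor)
  show "x \<le> inf y z" if "x \<le> y" "x \<le> z"
    using that by (auto simp: less_eq_tensor_def Rep_inf_tensor)
  have "Rep_tensor x \<union> Rep_tensor y \<subseteq> Rep_tensor (sup x y)"
    using ideal_hull_le_iff[of _ "sup x y"] by (auto simp: sup_tensor_def Rep_ideal_hull)
  then show "x \<le> sup x y" "y \<le> sup x y"
    by (auto simp: less_eq_tensor_def)
  show "sup y z \<le> x" if "y \<le> x" "z \<le> x"
    using that unfolding sup_tensor_def ideal_hull_le_iff by (simp add: less_eq_tensor_def)
  show "Inf A \<le> x" if "x \<in> A"
    using that by (auto simp: less_eq_tensor_def Rep_Inf_tensor)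
  show "z \<le> Inf A" if "\<And>x. x \<in> A \<Longrightarrow> z \<le> x"
    using that by (auto simp: less_eq_tensor_def Rep_Inf_tensor)
  show "x \<le> Sup A" if "x \<in> A"
    using that by (auto simp: less_eq_tensor_def Sup_tensor_def Rep_ideal_hull)
  show "Sup A \<le> z" if "\<And>x. x \<in> A \<Longrightarrow> x \<le> z"
    using that unfolding Sup_tensor_def ideal_hull_le_iff by (auto simp: less_eq_tensor_def)
  show "Inf {} = (top :: ('a, 'b) tensor)"
    by (simp add: Inf_tensor_def top_tensor_def)
  show "Sup {} = (bot :: ('a, 'b) tensor)"
    by (simp add: Sup_tensor_def bot_tensor_def)
qed

end

lemma inf_Sup_frame': "inf (Sup A) x = Sup ((\<lambda>a. inf a x) ` A)" for x :: "'a::frame"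
  using inf_Sup_frame[of x A] by (simp add: inf.commute)

lemma mem_Rep_mono: "(a, b) \<in> Rep_tensor x \<Longrightarrow> c \<le> a \<Longrightarrow> d \<le> b \<Longrightarrow> (c, d) \<in> Rep_tensor x"
  using coproduct_ideal_Rep[of x, unfolded coproduct_ideal_def, THEN conjunct1] by blast

lemma mem_Rep_Sup1: "(\<And>a. a \<in> A \<Longrightarrow> (a, b) \<in> Rep_tensor x) \<Longrightarrow> (Sup A, b) \<in> Rep_tensor x"
  by (rule coproduct_ideal_Rep[of x, unfolded coproduct_ideal_def, THEN conjunct2, THEN conjunct1,
        rule_format])

lemma mem_Rep_Sup2: "(\<And>b. b \<in> B \<Longrightarrow> (a, b) \<in> Rep_tensor x) \<Longrightarrow> (a, Sup B) \<in> Rep_tensor x"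
  by (rule coproduct_ideal_Rep[of x, unfolded coproduct_ideal_def, THEN conjunct2, THEN conjunct2,
        rule_format])

instance tensor :: (frame, frame) frame
proof
  fix x :: "('a, 'b) tensor" and A
  let ?E = "Sup (inf x ` A)"
  let ?J = "{(a, b). \<forall>c d. (c, d) \<in> Rep_tensor x \<longrightarrow> (inf a c, inf b d) \<in> Rep_tensor ?E}"
  have J: "coproduct_ideal ?J"
    unfolding coproduct_ideal_def
  proof (intro conjI allI impI)
    fix a c :: 'a and b d :: 'b
    assume "(a, b) \<in> ?J" "c \<le> a" "d \<le> b"
    then show "(c, d) \<in> ?J"
      using inf_mono[OF \<open>c \<le> a\<close> order.refl] inf_mono[OF \<open>d \<le> b\<close> order.refl]
      by (blast intro: mem_Rep_mono)
  next
    fix B :: "'a set" and b :: 'b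
    assume "\<forall>a\<in>B. (a, b) \<in> ?J"
    then show "(Sup B, b) \<in> ?J"
      by (auto simp: inf_Sup_frame' intro!: mem_Rep_Sup1)
  next
    fix a :: 'a and B :: "'b set"
    assume "\<forall>b\<in>B. (a, b) \<in> ?J"
    then show "(a, Sup B) \<in> ?J"
      by (auto simp: inf_Sup_frame' intro!: mem_Rep_Sup2)
  qed
  have "y \<le> Abs_tensor ?J" if "y \<in> A" for y
  proof -
    have "inf x y \<le> ?E"
      using that by (intro Sup_upper) auto
    then have E: "Rep_tensor x \<inter> Rep_tensor y \<subseteq> Rep_tensor ?E"
      by (simp add: less_eq_tensor_def Rep_inf_tensor)
    have "(a, b) \<in> ?J" if "(a, b) \<in> Rep_tensor y" for a b
      using E mem_Rep_mono[OF that inf_le1 inf_le1] mem_Rep_mono[OF _ inf_le2 inf_le2] by blast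
    then show ?thesis
      using J by (auto simp: less_eq_tensor_def Abs_tensor_inverse)
  qed
  then have "Sup A \<le> Abs_tensor ?J"
    by (rule Sup_least)
  then have SJ: "Rep_tensor (Sup A) \<subseteq> ?J"
    using J by (simp add: less_eq_tensor_def Abs_tensor_inverse)
  have "(a, b) \<in> Rep_tensor ?E" if "(a, b) \<in> Rep_tensor x" "(a, b) \<in> Rep_tensor (Sup A)" for a b
  proof -
    have "(inf a a, inf b b) \<in> Rep_tensor ?E"
      using SJ that by blast
    then show ?thesis by simp
  qed
  then have "inf x (Sup A) \<le> ?E"
    by (auto simp: less_eq_tensor_def Rep_inf_tensor)
  moreover have "?E \<le> inf x (Sup A)"
    by (auto intro!: Sup_least intro: le_infI2 Sup_upper)
  ultimately show "inf x (Sup A) = Sup (inf x ` A)"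
    by (rule order.antisym)
qed

definition rect :: "'a::frame \<Rightarrow> 'b::frame \<Rightarrow> ('a, 'b) tensor" where
  "rect a b = ideal_hull {(a, b)}"

definition iota1 :: "'a::frame \<Rightarrow> ('a, 'b::frame) tensor" where
  "iota1 a = rect a top"

definition iota2 :: "'b::frame \<Rightarrow> ('a::frame, 'b) tensor" where
  "iota2 b = rect top b"

lemma rect_le_iff: "rect a b \<le> x \<longleftrightarrow> (a, b) \<in> Rep_tensor x"
  by (simp add: rect_def ideal_hull_le_iff)

lemma Rep_rect: "Rep_tensor (rect a b) = {(c, d). c \<le> a \<and> d \<le> b \<or> c = bot \<or> d = bot}" (is "_ = ?D")
proof
  have "coproduct_ideal ?D"
    unfolding coproduct_ideal_def
  proof (intro conjI allI impI)
    fix c e and d f assume "(c, d) \<in> ?D" "e \<le> c" "f \<le> d"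
    then show "(e, f) \<in> ?D"
      by (auto simp: le_bot intro: order.trans)
  next
    fix A d assume A: "\<forall>c\<in>A. (c, d) \<in> ?D"
    show "(Sup A, d) \<in> ?D"
    proof (cases "d = bot \<or> Sup A = bot")
      case False
      then obtain c where "c \<in> A" "c \<noteq> bot"
        by (auto simp: Sup_bot_conv)
      with A False have "d \<le> b" by blast
      moreover have "Sup A \<le> a"
        using A False by (intro Sup_least) auto
      ultimately show ?thesis by simp
    qed auto
  next
    fix c B assume B: "\<forall>d\<in>B. (c, d) \<in> ?D"
    show "(c, Sup B) \<in> ?D"
    proof (cases "c = bot \<or> Sup B = bot")
      case False
      then obtain d where "d \<in> B" "d \<noteq> bot"
        by (auto simp: Sup_bot_conv)
      with B False have "c \<le> a" by blast
      moreover have "Sup B \<le> b"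
        using B False by (intro Sup_least) auto
      ultimately show ?thesis by simp
    qed auto
  qed
  then show "Rep_tensor (rect a b) \<subseteq> ?D"
    by (auto simp: rect_def Rep_ideal_hull)
next
  have ab: "(a, b) \<in> Rep_tensor (rect a b)"
    by (simp add: rect_le_iff[symmetric])
  have "(bot, d) \<in> Rep_tensor (rect a b)" "(c, bot) \<in> Rep_tensor (rect a b)" for c d
    using mem_Rep_Sup1[of "{}" d] mem_Rep_Sup2[of "{}" c] by auto
  then show "?D \<subseteq> Rep_tensor (rect a b)"
    using ab by (auto intro: mem_Rep_mono)
qed

lemma rect_inf_rect: "inf (rect a b) (rect c d) = rect (inf a c) (inf b d)"
  by (auto simp: Rep_tensor_inject[symmetric] Rep_inf_tensor Rep_rect)

lemma rect_eq_inf_iota: "rect a b = inf (iota1 a) (iota2 b)"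
  by (simp add: iota1_def iota2_def rect_inf_rect)

lemma tensor_eq_Sup_rect: "x = Sup {rect a b |a b. rect a b \<le> x}"
proof (rule order.antisym)
  show "x \<le> Sup {rect a b |a b. rect a b \<le> x}"
  proof (subst less_eq_tensor_def, rule subrelI)
    fix a b assume "(a, b) \<in> Rep_tensor x"
    then have "rect a b \<le> Sup {rect a b |a b. rect a b \<le> x}"
      by (intro Sup_upper) (auto simp: rect_le_iff)
    then show "(a, b) \<in> Rep_tensor (Sup {rect a b |a b. rect a b \<le> x})"
      by (simp add: rect_le_iff)
  qed
qed (auto intro: Sup_least)

lemma frame_map_iota1: "frame_map (iota1 :: 'a \<Rightarrow> ('a::frame, 'b::frame) tensor)"
  unfolding frame_map_iff
proof (intro conjI allI)
  fix A :: "'a set"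
  show "iota1 (Sup A) = (Sup (iota1 ` A) :: ('a, 'b) tensor)"
  proof (rule order.antisym)
    show "iota1 (Sup A) \<le> (Sup (iota1 ` A) :: ('a, 'b) tensor)"
      unfolding iota1_def rect_le_iff
      by (rule mem_Rep_Sup1) (auto simp: rect_le_iff[symmetric] intro: Sup_upper)
  qed (auto intro!: Sup_least simp: iota1_def rect_le_iff Rep_rect Sup_upper)
qed (auto simp: iota1_def rect_inf_rect Rep_tensor_inject[symmetric] Rep_rect Rep_top_tensor)

lemma frame_map_iota2: "frame_map (iota2 :: 'b \<Rightarrow> ('a::frame, 'b::frame) tensor)"
  unfolding frame_map_iff
proof (intro conjI allI)
  fix B :: "'b set"
  show "iota2 (Sup B) = (Sup (iota2 ` B) :: ('a, 'b) tensor)"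
  proof (rule order.antisym)
    show "iota2 (Sup B) \<le> (Sup (iota2 ` B) :: ('a, 'b) tensor)"
      unfolding iota2_def rect_le_iff
      by (rule mem_Rep_Sup2) (auto simp: rect_le_iff[symmetric] intro: Sup_upper)
  qed (auto intro!: Sup_least simp: iota2_def rect_le_iff Rep_rect Sup_upper)
qed (auto simp: iota2_def rect_inf_rect Rep_tensor_inject[symmetric] Rep_rect Rep_top_tensor)

lemma tensor_universal:
  fixes f :: "'a::frame \<Rightarrow> 'c::frame" and g :: "'b::frame \<Rightarrow> 'c"
  assumes f: "frame_map f" and g: "frame_map g"
  shows "\<exists>!h. frame_map h \<and> h \<circ> iota1 = f \<and> h \<circ> iota2 = g"
proof -
  have fS: "f (Sup A) = Sup (f ` A)" and ft: "f top = top" and fi: "f (inf a a') = inf (f a) (f a')"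
    for A a a' using f by (auto simp: frame_map_iff)
  have gS: "g (Sup A) = Sup (g ` A)" and gt: "g top = top" and gi: "g (inf b b') = inf (g b) (g b')"
    for A b b' using g by (auto simp: frame_map_iff)
  have f_mono: "f a \<le> f a'" if "a \<le> a'" for a a'
    using fi[of a a'] that by (simp add: inf.absorb1 inf.absorb_iff1)
  have g_mono: "g b \<le> g b'" if "b \<le> b'" for b b'
    using gi[of b b'] that by (simp add: inf.absorb1 inf.absorb_iff1)
  define h where "h x = Sup {inf (f a) (g b) |a b. (a, b) \<in> Rep_tensor x}" for x
  define k where "k z = {(a, b). inf (f a) (g b) \<le> z}" for z
  have k: "coproduct_ideal (k z)" for z
    unfolding coproduct_ideal_def k_def
    by (auto simp: fS gS inf_Sup_frame inf_Sup_frame' intro!: Sup_least)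
      (meson f_mono g_mono inf_mono order.trans)
  have Rep_k: "Rep_tensor (Abs_tensor (k z)) = k z" for z
    using k by (simp add: Abs_tensor_inverse)
  have adj: "h x \<le> z \<longleftrightarrow> x \<le> Abs_tensor (k z)" for x z
    unfolding h_def Sup_le_iff less_eq_tensor_def Rep_k by (auto simp: k_def)
  have h_mono: "h x \<le> h y" if "x \<le> y" for x y
    using that adj[of y "h y"] adj[of x "h y"] by (meson order.trans order.refl)
  have h_Sup: "h (Sup A) = Sup (h ` A)" for A
  proof (rule order.antisym)
    have "y \<le> Abs_tensor (k (Sup (h ` A)))" if "y \<in> A" for y
      unfolding adj[symmetric] using that by (auto intro: Sup_upper)
    then show "h (Sup A) \<le> Sup (h ` A)"
      by (simp add: adj Sup_le_iff)
  qed (auto intro!: Sup_least h_mono Sup_upper)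
  have h_upper: "inf (f a) (g b) \<le> h x" if "(a, b) \<in> Rep_tensor x" for a b x
    unfolding h_def using that by (intro Sup_upper) auto
  have h_rect: "h (rect a b) = inf (f a) (g b)" for a b
  proof (rule order.antisym)
    show "h (rect a b) \<le> inf (f a) (g b)"
      unfolding adj rect_le_iff Rep_k by (simp add: k_def)
  qed (auto intro!: h_upper simp: rect_le_iff[symmetric])
  have h_inf: "h (inf x y) = inf (h x) (h y)" for x y
  proof (rule order.antisym)
    have "inf (inf (f a) (g b)) (inf (f c) (g d)) \<le> h (inf x y)"
      if "(a, b) \<in> Rep_tensor x" "(c, d) \<in> Rep_tensor y" for a b c d
    proof -
      have "inf (f (inf a c)) (g (inf b d)) \<le> h (inf x y)"
        using that by (intro h_upper) (auto simp: Rep_inf_tensor intro: mem_Rep_mono)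
      then show ?thesis by (simp add: fi gi ac_simps)
    qed
    then show "inf (h x) (h y) \<le> h (inf x y)"
      unfolding h_def[of x] h_def[of y]
      by (auto simp: inf_Sup_frame inf_Sup_frame' intro!: Sup_least)
  qed (auto intro: h_mono)
  have "h top = top"
    using h_upper[of top top top] by (simp add: ft gt Rep_top_tensor top_le)
  then have "frame_map h"
    by (simp add: frame_map_iff h_Sup h_inf)
  moreover have "h \<circ> iota1 = f" "h \<circ> iota2 = g"
    by (auto simp: iota1_def iota2_def h_rect ft gt)
  moreover have "h' = h" if h': "frame_map h'" "h' \<circ> iota1 = f" "h' \<circ> iota2 = g" for h'
  proof
    fix x :: "('a, 'b) tensor"
    have r: "h' (rect a b) = h (rect a b)" for a b
    proof -
      have "h' (rect a b) = inf (h' (iota1 a)) (h' (iota2 b))"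
        using h'(1) by (simp add: rect_eq_inf_iota frame_map_iff)
      then show ?thesis
        using h'(2,3) by (simp add: h_rect fun_eq_iff)
    qed
    let ?A = "{rect a b |a b. rect a b \<le> x}"
    have "h' x = h' (Sup ?A)"
      using tensor_eq_Sup_rect[of x] by simp
    also have "\<dots> = Sup (h' ` ?A)"
      using h'(1) by (simp add: frame_map_iff)
    also have "h' ` ?A = h ` ?A"
      using r by (intro image_cong) auto
    also have "Sup (h ` ?A) = h x"
      using tensor_eq_Sup_rect[of x] by (simp add: h_Sup[symmetric])
    finally show "h' x = h x" .
  qed
  ultimately show ?thesis
    by blast
qed


section \<open>Sublocales\<close>

text \<open>
  A sublocale of a locale with frame of opens \<open>'p\<close> is given by its frame of opens \<open>S\<close> and
  the inverse image \<open>f\<close> of its inclusion.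
\<close>

definition sublocale_on :: "'q::order set \<Rightarrow> ('p::frame \<Rightarrow> 'q) \<Rightarrow> bool" where
  "sublocale_on S f \<longleftrightarrow> frame_on S \<and> frame_map_on UNIV S f \<and> f ` UNIV = S"

text \<open>A locale map from \<open>A\<close> to \<open>B\<close> over the ambient locale is a frame map from \<open>T\<close> to \<open>S\<close> under \<open>'p\<close>.\<close>

definition sublocale_le ::
  "'q::order set \<Rightarrow> ('p::frame \<Rightarrow> 'q) \<Rightarrow> 's::order set \<Rightarrow> ('p \<Rightarrow> 's) \<Rightarrow> bool" where
  "sublocale_le S f T g \<longleftrightarrow> (\<exists>h. frame_map_on T S h \<and> f = h \<circ> g)"


section \<open>Localic relations with open cones\<close>

definition is_left_adjoint :: "('p::order \<Rightarrow> 'q::order) \<Rightarrow> ('q \<Rightarrow> 'p) \<Rightarrow> bool" where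
  "is_left_adjoint g f \<longleftrightarrow> (\<forall>u v. g u \<le> v \<longleftrightarrow> u \<le> f v)"

definition direct_image :: "('q::frame \<Rightarrow> 'p::frame) \<Rightarrow> 'p \<Rightarrow> 'q" where
  "direct_image f = (THE g. is_left_adjoint g f)"

definition open_map :: "('q::frame \<Rightarrow> 'p::frame) \<Rightarrow> bool" where
  "open_map f \<longleftrightarrow>
    (\<exists>g. is_left_adjoint g f \<and> (\<forall>u v. g (inf u (f v)) = inf (g u) v))"

lemma direct_image_eqI:
  assumes "is_left_adjoint g f"
  shows "direct_image f = g"
  unfolding direct_image_def
proof (rule the_equality)
  fix g' assume "is_left_adjoint g' f"
  with assms show "g' = g"
    unfolding is_left_adjoint_def by (intro ext order.antisym) (blast intro: order.refl)+
qed (fact assms)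

text \<open>In what follows \<open>r\<close> is the inverse image of the inclusion of a relation in \<open>X \<times> X\<close>.\<close>

definition localic_relation :: "(('a::frame, 'a) tensor \<Rightarrow> 'r::frame) \<Rightarrow> bool" where
  "localic_relation r \<longleftrightarrow> sublocale_on UNIV r"

definition source_inv :: "(('a::frame, 'a) tensor \<Rightarrow> 'r::frame) \<Rightarrow> 'a \<Rightarrow> 'r" where
  "source_inv r = r \<circ> iota1"

definition target_inv :: "(('a::frame, 'a) tensor \<Rightarrow> 'r::frame) \<Rightarrow> 'a \<Rightarrow> 'r" where
  "target_inv r = r \<circ> iota2"

definition has_open_cones :: "(('a::frame, 'a) tensor \<Rightarrow> 'r::frame) \<Rightarrow> bool" where
  "has_open_cones r \<longleftrightarrow> open_map (source_inv r) \<and> open_map (target_inv r)"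

definition up_cone :: "(('a::frame, 'a) tensor \<Rightarrow> 'r::frame) \<Rightarrow> 'a \<Rightarrow> 'a" where
  "up_cone r = direct_image (target_inv r) \<circ> source_inv r"

definition down_cone :: "(('a::frame, 'a) tensor \<Rightarrow> 'r::frame) \<Rightarrow> 'a \<Rightarrow> 'a" where
  "down_cone r = direct_image (source_inv r) \<circ> target_inv r"

lemma localic_relation_iff: "localic_relation r \<longleftrightarrow> frame_map r \<and> surj r"
  by (simp add: localic_relation_def sublocale_on_def frame_on_UNIV)


section \<open>The relation induced by a pair of functions\<close>

text \<open>
  The intended arguments are join-preserving parallel pairs, such as the cones of a relation with
  open cones (\<open>parallel_cones\<close>, \<open>up_cone_Sup\<close>, \<open>down_cone_Sup\<close>); the saturated elements
  form a sublocale for arbitrary \<open>u\<close> and \<open>d\<close>.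
\<close>

definition parallel :: "('a::frame \<Rightarrow> 'a) \<Rightarrow> ('a \<Rightarrow> 'a) \<Rightarrow> bool" where
  "parallel u d \<longleftrightarrow>
    (\<forall>x y. inf (u x) y \<le> u (inf x (d y)) \<and> inf x (d y) \<le> d (inf (u x) y))"

text \<open>
  All empty rectangles are equal, hence the quantification over the sides of \<open>p\<close> and
  \<open>q\<close>. For \<open>u\<close> and \<open>d\<close> preserving the bottom element the choice is immaterial, since both
  of the compared meets are then bottom for any empty rectangle.
\<close>

definition rect_rel ::
  "('a::frame \<Rightarrow> 'a) \<Rightarrow> ('a \<Rightarrow> 'a) \<Rightarrow> ('a, 'a) tensor \<Rightarrow> ('a, 'a) tensor \<Rightarrow> bool" where
  "rect_rel u d p q \<longleftrightarrow>
    (\<exists>a b a' b'. p = rect a b \<and> q = rect a' b' \<and>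
      inf (u a) b = inf (u a') b' \<and> inf a (d b) = inf a' (d b'))"

definition saturated :: "('p::frame \<Rightarrow> 'p \<Rightarrow> bool) \<Rightarrow> 'p \<Rightarrow> bool" where
  "saturated rel z \<longleftrightarrow> (\<forall>p q w. rel p q \<longrightarrow> (inf p w \<le> z \<longleftrightarrow> inf q w \<le> z))"

definition saturation :: "('p::frame \<Rightarrow> 'p \<Rightarrow> bool) \<Rightarrow> 'p \<Rightarrow> 'p" where
  "saturation rel z = (LEAST y. saturated rel y \<and> z \<le> y)"

definition induced_opens :: "('a::frame \<Rightarrow> 'a) \<Rightarrow> ('a \<Rightarrow> 'a) \<Rightarrow> ('a, 'a) tensor set" where
  "induced_opens u d = {z. saturated (rect_rel u d) z}"

definition induced_inv ::
  "('a::frame \<Rightarrow> 'a) \<Rightarrow> ('a \<Rightarrow> 'a) \<Rightarrow> ('a, 'a) tensor \<Rightarrow> ('a, 'a) tensor" where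
  "induced_inv u d = saturation (rect_rel u d)"

lemma saturated_Inf: "(\<And>z. z \<in> A \<Longrightarrow> saturated rel z) \<Longrightarrow> saturated rel (Inf A)"
  unfolding saturated_def le_Inf_iff by blast

lemma saturation_eq: "saturation rel z = Inf {y. saturated rel y \<and> z \<le> y}"
  unfolding saturation_def
  by (rule Least_equality) (auto intro: saturated_Inf Inf_greatest Inf_lower)

lemma saturated_saturation: "saturated rel (saturation rel z)"
  by (auto simp: saturation_eq intro: saturated_Inf)

lemma le_saturation: "z \<le> saturation rel z"
  by (auto simp: saturation_eq intro: Inf_greatest)

lemma saturation_le_iff: "saturated rel y \<Longrightarrow> saturation rel z \<le> y \<longleftrightarrow> z \<le> y"
  by (auto simp: saturation_eq intro: Inf_lower order.trans[OF le_saturation[unfolded saturation_eq]])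

lemma saturation_inf: "saturation rel (inf x y) = inf (saturation rel x) (saturation rel y)"
proof (rule order.antisym)
  let ?s = "saturation rel"
  have imp: "\<exists>k. saturated rel k \<and> (\<forall>w. w \<le> k \<longleftrightarrow> inf w b \<le> z)" if z: "saturated rel z" for b z
  proof -
    define k where "k = Sup {w. inf w b \<le> z}"
    have k: "w \<le> k \<longleftrightarrow> inf w b \<le> z" for w
    proof
      assume "w \<le> k"
      then have "inf w b \<le> inf k b" by (intro inf_mono) auto
      also have "\<dots> \<le> z" unfolding k_def inf_Sup_frame' by (auto intro: Sup_least)
      finally show "inf w b \<le> z" .
    qed (auto simp: k_def intro: Sup_upper)
    moreover have "saturated rel k"
      using z unfolding saturated_def k by (simp add: inf.assoc)
    ultimately show ?thesis by blast
  qed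
  obtain k where k: "saturated rel k" "\<And>w. w \<le> k \<longleftrightarrow> inf w y \<le> ?s (inf x y)"
    using imp[OF saturated_saturation] by metis
  have "x \<le> k" unfolding k by (rule le_saturation)
  then have "?s x \<le> k" by (simp add: saturation_le_iff k(1))
  then have sx: "inf (?s x) y \<le> ?s (inf x y)" unfolding k(2) .
  obtain k' where k': "saturated rel k'" "\<And>w. w \<le> k' \<longleftrightarrow> inf w (?s x) \<le> ?s (inf x y)"
    using imp[OF saturated_saturation] by metis
  have "y \<le> k'" unfolding k' using sx by (simp add: inf.commute)
  then have "?s y \<le> k'" by (simp add: saturation_le_iff k'(1))
  then show "inf (?s x) (?s y) \<le> ?s (inf x y)"
    unfolding k'(2) by (simp add: inf.commute)
  have "saturated rel (inf (?s x) (?s y))"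
    using saturated_saturation[of rel x] saturated_saturation[of rel y]
    unfolding saturated_def le_inf_iff by blast
  then show "?s (inf x y) \<le> inf (?s x) (?s y)"
    unfolding saturation_le_iff[OF \<open>saturated rel (inf (?s x) (?s y))\<close>]
    by (intro inf_mono le_saturation)
qed

lemma saturation_ident: "saturated rel z \<Longrightarrow> saturation rel z = z"
  by (simp add: order.antisym le_saturation saturation_le_iff)

lemma sublocale_saturated:
  fixes rel :: "'p::frame \<Rightarrow> 'p \<Rightarrow> bool"
  shows "sublocale_on {z. saturated rel z} (saturation rel)"
proof -
  let ?S = "{z. saturated rel z}" and ?s = "saturation rel"
  have lub: "isLub ?S A x \<longleftrightarrow> x = ?s (Sup A)" for A x
  proof -
    have "isLub ?S A (?s (Sup A))"
      by (auto simp: isLub_iff saturated_saturation saturation_le_iff Sup_le_iff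
          intro: order.trans[OF Sup_upper le_saturation])
    then show ?thesis
      by (auto simp: isLub_iff intro!: order.antisym)
  qed
  have glb: "isGlb ?S A x \<longleftrightarrow> x = Inf A" if "A \<subseteq> ?S" for A x
  proof -
    have "isGlb ?S A (Inf A)"
      using that by (auto simp: isGlb_iff le_Inf_iff intro: saturated_Inf Inf_lower)
    then show ?thesis
      by (auto simp: isGlb_iff intro!: order.antisym)
  qed
  have s_Sup: "?s (Sup (?s ` A)) = ?s (Sup A)" for A
  proof (rule order.antisym)
    show "?s (Sup (?s ` A)) \<le> ?s (Sup A)"
      by (auto simp: saturation_le_iff saturated_saturation Sup_le_iff
          intro: order.trans[OF Sup_upper le_saturation])
    show "?s (Sup A) \<le> ?s (Sup (?s ` A))"
      unfolding saturation_le_iff[OF saturated_saturation] Sup_le_iff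
      by (meson Sup_upper imageI le_saturation order.trans)
  qed
  have "frame_on ?S"
    unfolding frame_on_def
  proof (intro conjI allI impI ballI)
    fix x A y m
    assume x: "x \<in> ?S" and A: "A \<subseteq> ?S" and y: "isLub ?S A y" and m: "isGlb ?S {x, y} m"
    have yA: "y = ?s (Sup A)"
      using y lub by blast
    then have "y \<in> ?S" by (simp add: saturated_saturation)
    then have "m = inf x y"
      using m x glb[of "{x, y}"] by auto
    also have "\<dots> = ?s (inf x (Sup A))"
      using x by (simp add: yA saturation_inf saturation_ident)
    finally have m': "m = ?s (Sup (inf x ` A))"
      by (simp add: inf_Sup_frame)
    have "{z. \<exists>a\<in>A. isGlb ?S {x, a} z} = inf x ` A"
    proof -
      have "isGlb ?S {x, a} z \<longleftrightarrow> z = inf x a" if "a \<in> A" for a z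
        using glb[of "{x, a}"] x A that by auto
      then show ?thesis by auto
    qed
    then show "isLub ?S {z. \<exists>a\<in>A. isGlb ?S {x, a} z} m"
      using m' lub by simp
  qed (use lub in blast)
  moreover have "frame_map_on UNIV ?S ?s"
    unfolding frame_map_on_def
  proof (intro conjI allI impI)
    fix A and x :: 'p assume "isLub UNIV A x"
    then show "isLub ?S (?s ` A) (?s x)"
      by (simp add: isLub_UNIV_iff lub s_Sup)
  next
    fix A and x :: 'p assume A: "finite A" and "isGlb UNIV A x"
    then have x: "x = Inf A" by (simp add: isGlb_UNIV_iff)
    have "?s (Inf A) = Inf (?s ` A)"
      using A
    proof induction
      case empty
      then show ?case using le_saturation[of top rel] by (simp add: top_le)
    qed (simp add: saturation_inf)
    moreover have "?s ` A \<subseteq> ?S"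
      by (auto simp: saturated_saturation)
    ultimately show "isGlb ?S (?s ` A) (?s x)"
      using glb x by blast
  qed (auto simp: saturated_saturation)
  moreover have "?s ` UNIV = ?S"
    using saturation_ident[of rel] saturated_saturation[of rel] by (auto simp: image_iff) metis
  ultimately show ?thesis
    by (simp add: sublocale_on_def)
qed

lemma sublocale_induced: "sublocale_on (induced_opens u d) (induced_inv u d)"
  unfolding induced_opens_def induced_inv_def by (rule sublocale_saturated)

context
  fixes r :: "('a::frame, 'a) tensor \<Rightarrow> 'r::frame"
  assumes rel: "localic_relation r" and open_cones: "has_open_cones r"
begin

lemma source_inv_Sup: "source_inv r (Sup A) = Sup (source_inv r ` A)"
  using rel frame_map_iota1[where 'a = 'a and 'b = 'a]
  by (simp add: source_inv_def localic_relation_iff frame_map_iff image_comp comp_def)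

lemma target_inv_Sup: "target_inv r (Sup A) = Sup (target_inv r ` A)"
  using rel frame_map_iota2[where 'a = 'a and 'b = 'a]
  by (simp add: target_inv_def localic_relation_iff frame_map_iff image_comp comp_def)

lemma direct_image_open:
  assumes "open_map (f :: 'a \<Rightarrow> 'r)"
  shows "direct_image f x \<le> y \<longleftrightarrow> x \<le> f y"
    and "direct_image f (inf x (f y)) = inf (direct_image f x) y"
proof -
  obtain g where "is_left_adjoint g f" "\<And>u v. g (inf u (f v)) = inf (g u) v"
    using assms unfolding open_map_def by blast
  then show "direct_image f x \<le> y \<longleftrightarrow> x \<le> f y"
    and "direct_image f (inf x (f y)) = inf (direct_image f x) y"
    by (simp_all add: direct_image_eqI is_left_adjoint_def)
qed

lemma direct_image_mono: "direct_image f x \<le> direct_image f y"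
  if "open_map (f :: 'a \<Rightarrow> 'r)" "x \<le> y"
  using that direct_image_open(1)[of f] by (meson order.refl order.trans)

lemma direct_image_Sup:
  assumes f: "open_map (f :: 'a \<Rightarrow> 'r)"
  shows "direct_image f (Sup A) = Sup (direct_image f ` A)"
proof (rule order.antisym)
  have "x \<le> f (Sup (direct_image f ` A))" if "x \<in> A" for x
    unfolding direct_image_open(1)[OF f, symmetric] using that by (auto intro: Sup_upper)
  then show "direct_image f (Sup A) \<le> Sup (direct_image f ` A)"
    by (simp add: direct_image_open(1)[OF f] Sup_le_iff)
qed (auto intro!: Sup_least direct_image_mono[OF f] Sup_upper)

lemma up_cone_Sup: "up_cone r (Sup A) = Sup (up_cone r ` A)"
  using open_cones
  by (simp add: up_cone_def has_open_cones_def source_inv_Sup direct_image_Sup image_comp comp_def)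

lemma down_cone_Sup: "down_cone r (Sup A) = Sup (down_cone r ` A)"
  using open_cones
  by (simp add: down_cone_def has_open_cones_def target_inv_Sup direct_image_Sup image_comp comp_def)

lemma source_inv_inf: "source_inv r (inf x y) = inf (source_inv r x) (source_inv r y)"
  using rel frame_map_iota1[where 'a = 'a and 'b = 'a] by (simp add: source_inv_def localic_relation_iff frame_map_iff)

lemma target_inv_inf: "target_inv r (inf x y) = inf (target_inv r x) (target_inv r y)"
  using rel frame_map_iota2[where 'a = 'a and 'b = 'a] by (simp add: target_inv_def localic_relation_iff frame_map_iff)

lemma parallel_cones: "parallel (up_cone r) (down_cone r)"
  unfolding parallel_def
proof (intro allI conjI)
  fix x y
  let ?s = "source_inv r" and ?t = "target_inv r"
  have s: "open_map ?s" and t: "open_map ?t"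
    using open_cones by (auto simp: has_open_cones_def)
  have unit: "z \<le> ?s (direct_image ?s z)" "z \<le> ?t (direct_image ?t z)" for z
    using direct_image_open(1)[OF s] direct_image_open(1)[OF t] by blast+
  have "inf (up_cone r x) y = direct_image ?t (inf (?s x) (?t y))"
    by (simp add: up_cone_def direct_image_open(2)[OF t])
  also have "\<dots> \<le> direct_image ?t (?s (inf x (down_cone r y)))"
    by (rule direct_image_mono[OF t])
      (auto simp: down_cone_def source_inv_inf intro: le_infI2 unit)
  finally show "inf (up_cone r x) y \<le> up_cone r (inf x (down_cone r y))"
    by (simp add: up_cone_def)
  have "inf x (down_cone r y) = direct_image ?s (inf (?t y) (?s x))"
    by (simp add: down_cone_def direct_image_open(2)[OF s] inf.commute[of x])
  also have "\<dots> \<le> direct_image ?s (?t (inf (up_cone r x) y))"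
    by (rule direct_image_mono[OF s])
      (auto simp: up_cone_def target_inv_inf intro: le_infI2 unit)
  finally show "inf x (down_cone r y) \<le> down_cone r (inf (up_cone r x) y)"
    by (simp add: down_cone_def)
qed

end

end

theory Submission
  imports Defs
begin

text \<open>
  The image of \<open>r (rect a b) = inf (source_inv r a) (target_inv r b)\<close> under the direct image along
  the target map is \<open>inf (up_cone r a) b\<close>, by Frobenius reciprocity, and under the one along the
  source map it is \<open>inf a (down_cone r b)\<close>. By the adjunctions, these two meets determine which
  elements of the form \<open>r (rect c d)\<close> lie above \<open>r (rect a b)\<close>. Hence \<open>r\<close> identifies related
  rectangles, and so factors through the quotient that the relation on rectangles generates.
\<close>

text \<open>The largest element whose image lies below \<open>f z\<close> is saturated, because
  \<open>f\<close> preserves binary meets and identifies related elements. It is above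
  \<open>z\<close>, hence above the saturation of \<open>z\<close>.\<close>

lemma frame_map_saturation:
  assumes f: "frame_map f" and rel: "\<And>p q. rel p q \<Longrightarrow> f p = f q"
  shows "f (saturation rel z) = f z"
proof (rule order.antisym)
  have fS: "f (Sup A) = Sup (f ` A)" and fi: "f (inf x y) = inf (f x) (f y)" for A x y
    using f by (auto simp: frame_map_iff)
  have f_mono: "f x \<le> f y" if "x \<le> y" for x y
    using fi[of x y] that by (simp add: inf.absorb1 inf.absorb_iff1)
  \<comment> \<open>The right adjoint of \<open>f\<close>, evaluated at \<open>f z\<close>.\<close>
  define y where "y = Sup {w. f w \<le> f z}"
  have y: "w \<le> y \<longleftrightarrow> f w \<le> f z" for w
  proof
    assume "w \<le> y"
    then have "f w \<le> f y" by (rule f_mono)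
    also have "\<dots> \<le> f z" by (auto simp: y_def fS intro: Sup_least)
    finally show "f w \<le> f z" .
  qed (auto simp: y_def intro: Sup_upper)
  have "saturated rel y"
    using rel by (auto simp: saturated_def y fi)
  moreover have "z \<le> y"
    by (simp add: y)
  ultimately have "saturation rel z \<le> y"
    by (simp only: saturation_le_iff)
  then show "f (saturation rel z) \<le> f z"
    by (simp add: y)
  show "f z \<le> f (saturation rel z)"
    by (intro f_mono le_saturation)
qed

text \<open>The mediating map is \<open>f\<close> itself, restricted to saturated elements: joins
  there are saturations of ambient joins, which \<open>f\<close> does not distinguish from the
  joins, and meets are ambient.\<close>

lemma sublocale_le_saturated:
  assumes f: "frame_map f" and rel: "\<And>p q. rel p q \<Longrightarrow> f p = f q"
  shows "sublocale_le UNIV f {z. saturated rel z} (saturation rel)"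
  unfolding sublocale_le_def
proof (intro exI conjI)
  let ?S = "{z. saturated rel z}"
  note f_sat = frame_map_saturation[of f rel, OF f rel]
  show "f = f \<circ> saturation rel"
    by (simp add: fun_eq_iff f_sat)
  show "frame_map_on ?S UNIV f"
    unfolding frame_map_on_def
  proof (intro conjI allI impI)
    fix A x assume "A \<subseteq> ?S" "isLub ?S A x"
    then have "x = saturation rel (Sup A)"
      using order.trans[OF Sup_upper le_saturation, of _ A rel]
      by (intro order.antisym) (auto simp: isLub_iff saturation_le_iff saturated_saturation Sup_le_iff)
    then show "isLub UNIV (f ` A) (f x)"
      using f by (simp add: f_sat isLub_UNIV_iff frame_map_iff)
  next
    fix A x assume A: "A \<subseteq> ?S" "finite A" "isGlb ?S A x"
    have "saturated rel (Inf A)"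
      using A(1) by (auto intro: saturated_Inf)
    then have "x = Inf A"
      using A(3) by (intro order.antisym) (auto simp: isGlb_iff le_Inf_iff Inf_lower)
    then show "isGlb UNIV (f ` A) (f x)"
      using f A(2) by (simp add: frame_map_on_def isGlb_UNIV_iff)
  qed simp
qed

lemma relation_rect:
  assumes "localic_relation r"
  shows "r (rect a b) = inf (source_inv r a) (target_inv r b)"
  using assms by (simp add: localic_relation_iff frame_map_iff rect_eq_inf_iota
      source_inv_def target_inv_def)

lemma relation_rect_le:
  assumes r: "localic_relation r" "has_open_cones r"
    and "inf (up_cone r a) b \<le> d" and "inf a (down_cone r b) \<le> c"
  shows "r (rect a b) \<le> r (rect c d)"
proof -
  let ?s = "source_inv r" and ?t = "target_inv r"
  have s: "open_map ?s" and t: "open_map ?t"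
    using r(2) by (auto simp: has_open_cones_def)
  have "direct_image ?t (inf (?s a) (?t b)) \<le> d"
    using assms(3) by (simp add: direct_image_open(2)[OF r t] up_cone_def)
  \<comment> \<open>The meet is swapped because Frobenius reciprocity expects the pulled-back factor
    on the right.\<close>
  moreover have "direct_image ?s (inf (?t b) (?s a)) \<le> c"
    using assms(4) by (simp add: direct_image_open(2)[OF r s] down_cone_def inf.commute[of a])
  ultimately show ?thesis
    by (simp add: direct_image_open(1)[OF r s] direct_image_open(1)[OF r t] relation_rect[OF r(1)]
        inf.commute)
qed

lemma relation_rect_eq:
  assumes r: "localic_relation r" "has_open_cones r"
    and "rect_rel (up_cone r) (down_cone r) p q"
  shows "r p = r q"
proof -
  obtain a b c d where pq: "p = rect a b" "q = rect c d"
    and u: "inf (up_cone r a) b = inf (up_cone r c) d"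
    and d: "inf a (down_cone r b) = inf c (down_cone r d)"
    using assms(3) unfolding rect_rel_def by blast
  \<comment> \<open>Each shared meet lies below the corresponding side of both rectangles, which
    gives both inequalities.\<close>
  have "inf (up_cone r a) b \<le> d" "inf a (down_cone r b) \<le> c"
    by (simp_all add: u d)
  moreover have "inf (up_cone r c) d \<le> b" "inf c (down_cone r d) \<le> a"
    by (simp_all flip: u d)
  ultimately show ?thesis
    unfolding pq by (intro order.antisym relation_rect_le[OF r])
qed

theorem proposition7p11:
  fixes r :: "('a::frame, 'a) tensor \<Rightarrow> 'r::frame"
  assumes "localic_relation r"
    and "has_open_cones r"
  shows "sublocale_le UNIV r
    (induced_opens (up_cone r) (down_cone r)) (induced_inv (up_cone r) (down_cone r))"
  unfolding induced_opens_def induced_inv_def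
  using assms by (intro sublocale_le_saturated relation_rect_eq) (auto simp: localic_relation_iff)

end
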